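(* Let $\beta_1,\beta_2>0$ be real numbers with $2\beta_1-\beta_2\geq 2\sqrt{2}\,r_0$, where $r_0\approx 0.546302$ is the positive root of the equation $r^2+2\cot(1)\,r-1=0$. Let $p$ be an analytic function in $\mathbb{D}$ with $p(0)=1$ and $$1+\beta_1 zp'(z)+\beta_2 z^2p''(z)\prec \frac{2}{1+e^{-z}}.$$ Then $p(z)\prec 1+\sinh^{-1}z$.
   Context: $\mathbb{D}=\{z\in\mathbb{C}:|z|<1\}$. For functions $f,g$ analytic in $\mathbb{D}$, $f\prec g$ ($f$ is subordinate to $g$) means there is an analytic $w:\mathbb{D}\to\mathbb{C}$ with $w(0)=0$ and $|w(z)|\leq|z|$ such that $f(z)=g(w(z))$ for all $z\in\mathbb{D}$. $\sinh^{-1}z=\log(z+\sqrt{1+z^2})$ is the principal branch of the inverse hyperbolic sine, analytic on $\mathbb{D}$ with value $0$ at $0$. *)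

theory Defs
  imports "HOL-Complex_Analysis.Complex_Analysis"
begin

(* Only meaningful for f, g analytic in the unit disc. *)
definition subordinate :: "(complex \<Rightarrow> complex) \<Rightarrow> (complex \<Rightarrow> complex) \<Rightarrow> bool"
    (infix "\<prec>\<^sub>s" 50) where
  "f \<prec>\<^sub>s g \<longleftrightarrow>
     (\<exists>w. w analytic_on ball 0 1 \<and> w 0 = 0 \<and>
          (\<forall>z\<in>ball 0 1. cmod (w z) \<le> cmod z) \<and>
          (\<forall>z\<in>ball 0 1. f z = g (w z)))"

end

theory Submission
  imports Defs
begin

text \<open>
  The equation for \<open>r\<^sub>0\<close> forces \<open>r\<^sub>0 \<ge> 1/2\<close>, hence \<open>\<beta>\<^sub>1 \<ge> 1/\<surd>2\<close>. Since
  \<open>2 / (1 + exp (- \<zeta>)) - 1\<close> is bounded by \<open>1/\<surd>3\<close> on the disc, the Schwarz lemma bounds it by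
  \<open>\<bar>\<zeta>\<bar>/\<surd>3\<close>, so that the subordination hypothesis gives
  \<open>\<bar>\<beta>\<^sub>1 p' + \<beta>\<^sub>2 z p''\<bar> \<le> 1/\<surd>3\<close>. Integrating this first order equation for \<open>p'\<close> along rays gives
  \<open>\<bar>p'\<bar> \<le> 1/(\<surd>3 \<beta>\<^sub>1)\<close>, and \<open>p - 1\<close> takes values in the disc of radius \<open>\<surd>(2/3)\<close>. There
  \<open>\<bar>sinh\<bar> < 1\<close>, so the Schwarz lemma applies to \<open>sinh (p - 1)\<close>.
\<close>

text \<open>Averaging the Taylor expansions of \<open>exp\<close> at x and -x cancels the odd terms.
  Since e < 2.72, the two fourth-order remainders together contribute at most x^4/8.\<close>

lemma cosh_upper_bound:
  fixes x :: real
  assumes "\<bar>x\<bar> \<le> 1"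
  shows "cosh x \<le> 1 + x\<^sup>2/2 + x^4/8"
proof -
  have exp_expansion: "\<exists>c<272/100. exp u = 1 + u + u\<^sup>2/2 + u^3/6 + c / 24 * u^4"
    if "\<bar>u\<bar> \<le> 1" for u :: real
  proof -
    obtain t where t: "\<bar>t\<bar> \<le> \<bar>u\<bar>" "exp u = (\<Sum>m<4. u ^ m / fact m) + exp t / fact 4 * u^4"
      using Maclaurin_exp_le[of u 4] by blast
    have "(\<Sum>m<4. u ^ m / fact m) = 1 + u + u\<^sup>2/2 + u^3/6"
      by (simp add: lessThan_nat_numeral fact_numeral)
    then have "exp u = 1 + u + u\<^sup>2/2 + u^3/6 + exp t / 24 * u^4"
      using t(2) by (simp add: fact_numeral)
    moreover have "exp t \<le> exp 1"
      using t(1) that by simp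
    then have "exp t < 272/100"
      using e_less_272 by linarith
    ultimately show ?thesis by blast
  qed
  obtain c d where cd: "c < 272/100" "d < 272/100"
    "exp x = 1 + x + x\<^sup>2/2 + x^3/6 + c / 24 * x^4"
    "exp (- x) = 1 - x + x\<^sup>2/2 - x^3/6 + d / 24 * x^4"
    using exp_expansion[of x] exp_expansion[of "- x"] assms by auto
  have "(c / 48 + d / 48) * x^4 \<le> 1/8 * x^4"
    using cd by (intro mult_right_mono) auto
  then show ?thesis
    using cd by (simp add: cosh_field_def algebra_simps add_divide_distrib)
qed

lemma cos_lower_bound:
  fixes y :: real
  shows "1 - y\<^sup>2/2 \<le> cos y"
proof -
  have "(sin (y/2))\<^sup>2 \<le> (y/2)\<^sup>2"
    using abs_sin_x_le_abs_x[of "y/2"] by (simp only: abs_le_square_iff)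
  then show ?thesis
    using cos_double_sin[of "y/2"] by (simp add: power2_eq_square)
qed

text \<open>As x^4 \<le> x^2, the left side is at most 1 + 5/8 x^2. The right side is at least 2 -
  y^2, and 5/8 x^2 + y^2 < 1.\<close>

lemma cosh_less_twice_cos:
  fixes x y :: real
  assumes "x\<^sup>2 + y\<^sup>2 < 1"
  shows "cosh x < 2 * cos y"
proof -
  have "x\<^sup>2 < 1" using assms by (smt (verit) zero_le_power2)
  then have "x^4 \<le> x\<^sup>2"
    using mult_left_le[of "x\<^sup>2" "x\<^sup>2"] by (simp add: power4_eq_xxxx power2_eq_square)
  moreover have "\<bar>x\<bar> \<le> 1"
    using \<open>x\<^sup>2 < 1\<close> by (simp add: abs_square_less_1 less_imp_le)
  ultimately show ?thesis
    using cosh_upper_bound[of x] cos_lower_bound[of y] assms zero_le_power2[of x]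
    by linarith
qed

text \<open>The shifted sigmoid is tanh (z/2), whose squared modulus is (cosh x - cos y) / (cosh x +
  cos y) for z = x + iy. This is below 1/3 exactly when cosh x < 2 cos y.\<close>

lemma norm_sigmoid_lt:
  fixes z :: complex
  assumes "cmod z < 1"
  shows "1 + exp (- z) \<noteq> 0" and "cmod (2 / (1 + exp (- z)) - 1) < 1 / sqrt 3"
proof -
  define x y e where "x = Re z" and "y = Im z" and "e = exp (- x)"
  have "x\<^sup>2 + y\<^sup>2 < 1"
    using assms by (metis abs_square_less_1 abs_norm_cancel cmod_power2 x_def y_def)
  then have lt: "cosh x < 2 * cos y" by (rule cosh_less_twice_cos)
  have e: "e > 0" "2 * (e * cosh x) = 1 + e\<^sup>2"
    by (simp_all add: e_def cosh_field_def power2_eq_square field_simps exp_minus)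
  have E: "Re (exp (- z)) = e * cos y" "Im (exp (- z)) = - e * sin y"
    by (simp_all add: Re_exp Im_exp e_def x_def y_def)
  have sq: "(e * sin y)\<^sup>2 = e\<^sup>2 - (e * cos y)\<^sup>2"
    using sin_cos_squared_add[of y] by (simp add: power_mult_distrib algebra_simps flip: distrib_left)
  have plus: "(cmod (1 + exp (- z)))\<^sup>2 = 2 * e * (cosh x + cos y)"
    using E e(2) sq by (simp add: cmod_power2 algebra_simps power2_sum)
  have minus: "(cmod (1 - exp (- z)))\<^sup>2 = 2 * e * (cosh x - cos y)"
    using E e(2) sq by (simp add: cmod_power2 algebra_simps power2_diff)
  have "cosh x > 0" by simp
  then have "cos y > 0" using lt by linarith
  show nz: "1 + exp (- z) \<noteq> 0"
  proof
    assume "1 + exp (- z) = 0"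
    with plus have "2 * e * (cosh x + cos y) = 0" by simp
    with e(1) have "cosh x + cos y = 0" by simp
    with \<open>cosh x > 0\<close> \<open>cos y > 0\<close> show False by linarith
  qed
  have "e * (3 * (cosh x - cos y)) < e * (cosh x + cos y)"
    using lt e by (intro mult_strict_left_mono) auto
  then have "(sqrt 3 * cmod (1 - exp (- z)))\<^sup>2 < (cmod (1 + exp (- z)))\<^sup>2"
    unfolding power_mult_distrib plus minus by (simp add: algebra_simps)
  then have "sqrt 3 * cmod (1 - exp (- z)) < cmod (1 + exp (- z))"
    by (rule power_less_imp_less_base) simp
  moreover have "2 / (1 + exp (- z)) - 1 = (1 - exp (- z)) / (1 + exp (- z))"
    using nz by (simp add: field_simps)
  ultimately show "cmod (2 / (1 + exp (- z)) - 1) < 1 / sqrt 3"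
    using nz by (simp add: norm_divide field_simps)
qed

lemma norm_sigmoid_le:
  fixes z :: complex
  assumes "cmod z < 1"
  shows "cmod (2 / (1 + exp (- z)) - 1) \<le> cmod z / sqrt 3"
proof -
  define h where "h = (\<lambda>w::complex. of_real (sqrt 3) * (2 / (1 + exp (- w)) - 1))"
  have "cmod (h z) \<le> cmod z"
  proof (rule Schwarz_Lemma(1))
    show "h holomorphic_on ball 0 1"
      unfolding h_def using norm_sigmoid_lt(1) by (intro holomorphic_intros) auto
    show "cmod (h w) < 1" if "cmod w < 1" for w
      using norm_sigmoid_lt(2)[OF that] by (simp add: h_def norm_mult pos_less_divide_eq mult.commute)
  qed (use assms in \<open>simp_all add: h_def\<close>)
  then show ?thesis
    by (simp add: h_def norm_mult pos_le_divide_eq mult.commute)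
qed

text \<open>For z = x + iy, the squared modulus sinh^2 x + sin^2 y is at most 7/5 x^2 + y^2, hence
  at most 2/3 + 2/5 * 2/3 = 14/15.\<close>

lemma norm_sinh_lt_one:
  fixes z :: complex
  assumes "(cmod z)\<^sup>2 \<le> 2/3"
  shows "cmod (sinh z) < 1"
proof -
  define x y where "x = Re z" and "y = Im z"
  have xy: "x\<^sup>2 + y\<^sup>2 \<le> 2/3"
    using assms by (simp add: cmod_power2 x_def y_def)
  then have x: "x\<^sup>2 \<le> 2/3" by (smt (verit) zero_le_power2)
  then have "\<bar>x\<bar> \<le> 1" by (simp add: abs_le_square_iff flip: abs_square_le_1)
  have "x^4 \<le> 2/3 * x\<^sup>2"
    using mult_right_mono[OF x zero_le_power2[of x]] by (simp add: power4_eq_xxxx power2_eq_square)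
  then have "cosh x \<le> 1 + 7/12 * x\<^sup>2"
    using cosh_upper_bound[OF \<open>\<bar>x\<bar> \<le> 1\<close>] by simp
  then have "(cosh x)\<^sup>2 \<le> (1 + 7/12 * x\<^sup>2)\<^sup>2"
    by (rule power_mono) simp
  also have "\<dots> = 1 + 7/6 * x\<^sup>2 + 49/144 * x^4"
    by (simp add: power2_eq_square power4_eq_xxxx algebra_simps)
  \<comment> \<open>Here 7/6 + 49/144 * 2/3 = 301/216 < 7/5.\<close>
  also have "\<dots> \<le> 1 + 7/5 * x\<^sup>2"
    using \<open>x^4 \<le> 2/3 * x\<^sup>2\<close> zero_le_power2[of x] by linarith
  finally have "(sinh x)\<^sup>2 \<le> 7/5 * x\<^sup>2"
    by (simp add: cosh_square_eq)
  moreover have "(sin y)\<^sup>2 \<le> y\<^sup>2"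
    using abs_sin_x_le_abs_x[of y] by (simp only: abs_le_square_iff)
  moreover have "(cmod (sinh z))\<^sup>2 = (sinh x)\<^sup>2 + (sin y)\<^sup>2"
  proof -
    have "(cmod (sinh z))\<^sup>2 = (exp (2 * x) + inverse (exp (2 * x)) - 2 * cos (2 * y)) / 4"
      using norm_sin_squared[of "\<i> * z"] by (simp add: sinh_conv_sin norm_mult x_def y_def)
    also have "exp (2 * x) + inverse (exp (2 * x)) = 4 * (sinh x)\<^sup>2 + 2"
      unfolding exp_double sinh_field_def exp_minus by (simp add: power2_eq_square field_simps)
    finally show ?thesis by (simp add: cos_double_sin)
  qed
  ultimately have "(cmod (sinh z))\<^sup>2 < 1"
    using xy x zero_le_power2[of y] by linarith
  then show ?thesis by (simp add: abs_square_less_1)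
qed

text \<open>In this strip cosh z has positive real part, so it is the principal root of 1 + sinh^2
  z. The logarithm then meets exp z, which it inverts because the imaginary part of z lies within
  (-pi, pi).\<close>

lemma arsinh_sinh_complex:
  fixes z :: complex
  assumes "\<bar>Im z\<bar> < pi / 2"
  shows "arsinh (sinh z) = z"
proof -
  have "Re (cosh z) = cosh (Re z) * cos (Im z)"
    by (simp add: cosh_field_def Re_exp field_simps)
  moreover have "cos (Im z) > 0"
    using assms by (intro cos_gt_zero_pi) auto
  ultimately have "Re (cosh z) > 0" by simp
  then have "csqrt ((sinh z)\<^sup>2 + 1) = cosh z"
    by (intro csqrt_unique) (auto simp: cosh_square_eq)
  then have "arsinh (sinh z) = ln (sinh z + cosh z)"
    by (simp add: arsinh_def csqrt_conv_powr)
  also have "\<dots> = z"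
    using assms by (simp add: sinh_plus_cosh)
  finally show ?thesis .
qed

text \<open>This crude bound is what makes the quadratic for \<open>r\<^sub>0\<close> negative on
  (0, 1/2).\<close>

lemma cot_one_le: "cot (1::real) \<le> 3/4"
proof -
  \<comment> \<open>5/6 = 1 - 1/3! is the Taylor polynomial and 1/120 = 1/5! the remainder
    bound.\<close>
  have "\<bar>sin 1 - 5/6\<bar> \<le> (1/120::real)"
    using Maclaurin_sin_bound[of 1 5]
    by (simp add: eval_nat_numeral sin_coeff_Suc cos_coeff_Suc)
  then have s: "sin (1::real) \<ge> 4/5" by linarith
  have "(cos 1)\<^sup>2 \<le> (3/5::real)\<^sup>2"
    using power_mono[OF s, of 2] sin_cos_squared_add[of "1::real"] by (simp add: power2_eq_square)
  then have "cos 1 \<le> (3/5::real)" by (rule power2_le_imp_le) simp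
  with s show ?thesis
    by (simp add: cot_def field_simps)
qed

text \<open>With \<open>c = b/a\<close>, the function \<open>t powr c * u (t z)\<close> has derivative
  \<open>t powr (c - 1) * (b * u (t z) + a * t * z * u' (t z)) / a\<close>.\<close>

lemma euler_operator_bound:
  fixes u :: "complex \<Rightarrow> complex" and a b B :: real
  assumes "a > 0" "b > 0" and hol: "u holomorphic_on ball 0 1"
    and bound: "\<And>z. cmod z < 1 \<Longrightarrow> cmod (of_real b * u z + of_real a * z * deriv u z) \<le> B"
    and z: "cmod z < 1"
  shows "cmod (u z) \<le> B / b"
proof -
  define c where "c = b / a"
  have c: "c > 0" "b = a * c" using assms(1,2) by (auto simp: c_def)
  have tz: "cmod (of_real t * z) < 1" if "0 \<le> t" "t \<le> 1" for t
    using z that mult_left_le_one_le[of "cmod z" t] by (simp add: norm_mult)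
  define g where "g = (\<lambda>t::real. of_real (t powr c) * u (of_real t * z))"
  define g' where "g' = (\<lambda>t::real. of_real (t powr c) * (z * deriv u (of_real t * z))
    + of_real (c * t powr (c - 1)) * u (of_real t * z))"
  have "cmod (g 1 - g 0) \<le> B / b * 1 powr c - B / b * 0 powr c"
  \<comment> \<open>This mean value bound asks for derivatives only in the open interval, so the
    singularity of \<open>t powr (c - 1)\<close> at 0 for c < 1 is harmless. The majorant
    \<open>B / b * t powr c\<close> is the solution with constant right-hand side B.\<close>
  proof (rule differentiable_bound_general)
    have "continuous_on {0..1} (\<lambda>t. u (of_real t * z))"
      by (rule continuous_on_compose2[OF holomorphic_on_imp_continuous_on[OF hol]])
        (auto intro!: continuous_intros tz)
    then show "continuous_on {0..1} g"
      unfolding g_def using c(1)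
      by (intro continuous_on_mult continuous_on_of_real continuous_on_powr') auto
    show "continuous_on {0..1} (\<lambda>t. B / b * t powr c)"
      using c(1) by (intro continuous_on_mult continuous_on_powr') auto
    fix t :: real assume t: "0 < t" "t < 1"
    have du: "(u has_field_derivative deriv u (of_real t * z)) (at (of_real t * z))"
      using tz[of t] t by (intro holomorphic_derivI[OF hol]) auto
    have "((\<lambda>s. u (of_real s * z)) has_vector_derivative z * deriv u (of_real t * z)) (at t)"
      by (rule field_vector_diff_chain_at[where f = "\<lambda>s. of_real s * z" and f' = z, OF _ du,
            unfolded o_def])
        (auto intro!: derivative_eq_intros)
    moreover have "((\<lambda>s. s powr c) has_real_derivative c * t powr (c - 1)) (at t)"
      using t by (intro has_real_derivative_powr)
    ultimately show "(g has_vector_derivative g' t) (at t)"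
      unfolding g_def g'_def
      by (intro has_vector_derivative_mult has_vector_derivative_of_real)
        (simp_all add: has_real_derivative_iff_has_vector_derivative)
    show "((\<lambda>t. B / b * t powr c) has_vector_derivative B / b * (c * t powr (c - 1))) (at t)"
      using t unfolding has_real_derivative_iff_has_vector_derivative[symmetric]
      by (intro DERIV_cmult has_real_derivative_powr)
    have "t powr c = t powr (c - 1) * t"
      using t by (simp add: powr_diff)
    then have "of_real a * g' t = of_real (t powr (c - 1)) *
      (of_real b * u (of_real t * z) + of_real a * (of_real t * z) * deriv u (of_real t * z))"
      unfolding g'_def c(2) by (simp add: algebra_simps)
    then have "a * cmod (g' t) = t powr (c - 1) *
      cmod (of_real b * u (of_real t * z) + of_real a * (of_real t * z) * deriv u (of_real t * z))"
      using \<open>a > 0\<close> by (metis abs_of_pos abs_of_nonneg norm_mult norm_of_real powr_ge_zero)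
    also have "\<dots> \<le> t powr (c - 1) * B"
      using tz[of t] t by (intro mult_left_mono bound) auto
    finally show "cmod (g' t) \<le> B / b * (c * t powr (c - 1))"
      using \<open>a > 0\<close> \<open>c > 0\<close> by (simp add: c(2) field_simps)
  qed simp
  then show ?thesis using c(1) by (simp add: g_def)
qed

theorem theorem3p3:
  fixes \<beta>\<^sub>1 \<beta>\<^sub>2 r\<^sub>0 :: real and p :: "complex \<Rightarrow> complex"
  assumes "\<beta>\<^sub>1 > 0" and "\<beta>\<^sub>2 > 0"
    and "r\<^sub>0 > 0" and "r\<^sub>0\<^sup>2 + 2 * cot 1 * r\<^sub>0 - 1 = 0"
    and "2 * \<beta>\<^sub>1 - \<beta>\<^sub>2 \<ge> 2 * sqrt 2 * r\<^sub>0"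
    and "p analytic_on ball 0 1" and "p 0 = 1"
    and "(\<lambda>z. 1 + of_real \<beta>\<^sub>1 * z * deriv p z + of_real \<beta>\<^sub>2 * z\<^sup>2 * deriv (deriv p) z)
           \<prec>\<^sub>s (\<lambda>z. 2 / (1 + exp (- z)))"
  shows "p \<prec>\<^sub>s (\<lambda>z. 1 + arsinh z)"
proof -
  have hol: "p holomorphic_on ball 0 1"
    using assms(6) by (simp add: analytic_on_open)
  \<comment> \<open>For 0 < r < 1/2 the quadratic is at most r/2 + 3/2 r - 1 = 2r - 1 < 0.\<close>
  have "r\<^sub>0 \<ge> 1/2"
  proof (rule ccontr)
    assume r: "\<not> r\<^sub>0 \<ge> 1/2"
    have "cot 1 * r\<^sub>0 \<le> 3/4 * r\<^sub>0"
      using cot_one_le \<open>r\<^sub>0 > 0\<close> by (intro mult_right_mono) auto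
    moreover have "r\<^sub>0\<^sup>2 \<le> 1/2 * r\<^sub>0"
      using r \<open>r\<^sub>0 > 0\<close> unfolding power2_eq_square by (intro mult_right_mono) auto
    ultimately show False
      using assms(4) r by linarith
  qed
  then have "sqrt 2 \<le> 2 * sqrt 2 * r\<^sub>0" by simp
  then have \<beta>\<^sub>1: "sqrt 2 \<le> 2 * \<beta>\<^sub>1" using assms(2,5) by linarith
  define R where "R = 1 / sqrt 3 / \<beta>\<^sub>1"
  have "R > 0" using \<open>\<beta>\<^sub>1 > 0\<close> by (simp add: R_def)
  have "1 \<le> 2 * \<beta>\<^sub>1\<^sup>2"
    using power_mono[OF \<beta>\<^sub>1, of 2] by (simp add: power_mult_distrib)
  then have R2: "R\<^sup>2 \<le> 2/3"
    using \<open>\<beta>\<^sub>1 > 0\<close> by (simp add: R_def power_divide power_mult_distrib divide_le_eq)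

  obtain w where "\<forall>z\<in>ball 0 1. cmod (w z) \<le> cmod z"
    "\<forall>z\<in>ball 0 1. 1 + of_real \<beta>\<^sub>1 * z * deriv p z + of_real \<beta>\<^sub>2 * z\<^sup>2 * deriv (deriv p) z
      = 2 / (1 + exp (- w z))"
    using assms(8) unfolding subordinate_def by (elim exE conjE)
  note w = this[THEN bspec, unfolded mem_ball_0]
  define F where "F = (\<lambda>z. of_real \<beta>\<^sub>1 * deriv p z + of_real \<beta>\<^sub>2 * z * deriv (deriv p) z)"
  have hol': "deriv p holomorphic_on ball 0 1" and hol'': "deriv (deriv p) holomorphic_on ball 0 1"
    using hol by (auto intro!: holomorphic_deriv)
  \<comment> \<open>Subordination controls only z F(z). The factor |z| gained from |w(z)| \<le> |z|
    cancels away from 0, and continuity of F then covers the origin.\<close>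
  have F_nz: "cmod (F z) \<le> 1 / sqrt 3" if "cmod z < 1" "z \<noteq> 0" for z
  proof -
    have "z * F z = 2 / (1 + exp (- w z)) - 1"
      unfolding w(2)[OF that(1), symmetric] F_def by (simp add: power2_eq_square algebra_simps)
    moreover have "cmod (2 / (1 + exp (- w z)) - 1) \<le> cmod (w z) / sqrt 3"
      using w(1)[OF that(1)] that(1) by (intro norm_sigmoid_le) auto
    ultimately have "cmod z * cmod (F z) \<le> cmod z * (1 / sqrt 3)"
      using divide_right_mono[OF w(1)[OF that(1)], of "sqrt 3"] by (simp flip: norm_mult)
    then show ?thesis
      by (rule mult_left_le_imp_le) (use that(2) in simp)
  qed
  have F: "cmod (F z) \<le> 1 / sqrt 3" if "cmod z < 1" for z
  proof (cases "z = 0")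
    case True
    have "F holomorphic_on ball 0 1"
      unfolding F_def by (intro holomorphic_intros hol' hol'')
    then have "isCont F 0"
      using continuous_on_eq_continuous_at[of "ball 0 1" F] holomorphic_on_imp_continuous_on by simp
    then have "((\<lambda>z. cmod (F z)) \<longlongrightarrow> cmod (F 0)) (at 0)"
      unfolding isCont_def by (rule tendsto_norm)
    moreover have "eventually (\<lambda>z. cmod (F z) \<le> 1 / sqrt 3) (at 0)"
      unfolding eventually_at by (intro exI[of _ 1]) (simp add: F_nz)
    ultimately show ?thesis
      unfolding True by (intro tendsto_upperbound) auto
  qed (use F_nz that in auto)
  have p': "cmod (deriv p z) \<le> R" if "cmod z < 1" for z
    unfolding R_def by (rule euler_operator_bound[OF assms(2,1) hol' F[unfolded F_def] that])
  have disc: "cmod (p z - 1) \<le> R" if "cmod z < 1" for z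
  proof -
    have "cmod (p z - p 0) \<le> R * cmod (z - 0)"
    proof (rule field_differentiable_bound[of "ball 0 1" p "deriv p"])
      show "(p has_field_derivative deriv p x) (at x within ball 0 1)" if "x \<in> ball 0 1" for x
        using that by (intro holomorphic_derivI[OF hol]) auto
    qed (use that in \<open>simp_all add: p'\<close>)
    also have "\<dots> \<le> R"
      using mult_left_le[of "cmod z" R] \<open>R > 0\<close> that by simp
    finally show ?thesis by (simp add: assms(7))
  qed
  have disc2: "(cmod (p z - 1))\<^sup>2 \<le> 2/3" if "cmod z < 1" for z
    using power_mono[OF disc[OF that] norm_ge_zero, of 2] R2 by linarith
  have hol_sinh: "(\<lambda>z. sinh (p z - 1)) holomorphic_on ball 0 1"
    unfolding sinh_field_def by (intro holomorphic_intros hol) auto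
  show ?thesis
    unfolding subordinate_def
  \<comment> \<open>The Schwarz function is found by solving p = 1 + arsinh w for w.\<close>
  proof (intro exI[of _ "\<lambda>z. sinh (p z - 1)"] conjI ballI)
    show "(\<lambda>z. sinh (p z - 1)) analytic_on ball 0 1"
      using hol_sinh by (simp add: analytic_on_open)
    show "sinh (p 0 - 1) = 0" by (simp add: assms(7))
    show "cmod (sinh (p z - 1)) \<le> cmod z" if "z \<in> ball 0 1" for z
      using that by (intro Schwarz_Lemma(1)[OF hol_sinh] norm_sinh_lt_one disc2)
        (simp_all add: assms(7))
    show "p z = 1 + arsinh (sinh (p z - 1))" if "z \<in> ball 0 1" for z
    proof -
      \<comment> \<open>The cosine bound at pi/2 reads 1 - (pi/2)^2/2 \<le> 0, so (pi/2)^2 \<ge> 2 >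
        2/3.\<close>
      have "(cmod (p z - 1))\<^sup>2 < (pi / 2)\<^sup>2"
        using disc2[of z] that cos_lower_bound[of "pi / 2"] by simp
      then have "cmod (p z - 1) < pi / 2"
        by (rule power2_less_imp_less) simp
      then have "\<bar>Im (p z - 1)\<bar> < pi / 2"
        using abs_Im_le_cmod[of "p z - 1"] by linarith
      then show ?thesis by (simp add: arsinh_sinh_complex)
    qed
  qed
qed

end
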